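(* Let $S$ be a semigroup with $|S|\ge 2$. If $S^1$ is uniform, then $S$ is uniform. Likewise, if $S^0$ is uniform, then $S$ is uniform.
   Context: A right $S$-act is a nonempty set $A$ with a map $A\times S\to A$, $(a,s)\mapsto as$, with $a(st)=(as)t$. A subact is a nonempty subset closed under the action; an $S$-homomorphism is a map $f$ with $f(as)=f(a)s$; a monomorphism is an injective $S$-homomorphism. A subact is nonzero if it is not a one-element subact. A subact $B$ of $A$ is large in $A$ if every $S$-homomorphism $g:A\to C$ (for any right $S$-act $C$) whose restriction to $B$ is injective is itself injective. A right $S$-act is uniform if every nonzero subact is large in it. A semigroup $S$ is uniform (i.e. right uniform) if the right $S$-act $S_S$ ($S$ acting on itself by right multiplication; its subacts are the nonempty right ideals) is uniform. $S^1$ is $S$ if $S$ has an identity element and otherwise $S\cup\{1\}$ with a new identity element $1$ adjoined. $S^0$ is $S$ if $S$ has a (two-sided) zero element and otherwise $S\cup\{0\}$ with a new zero element $0$ adjoined. *)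

theory Defs
  imports Main
begin

text \<open>
  Semigroups are given by a nonempty carrier set and an operation on the ambient type, because
  the adjunction of an identity or a zero depends on whether the carrier already has one.
\<close>

locale semigroup_on =
  fixes S :: "'s set" and mul :: "'s \<Rightarrow> 's \<Rightarrow> 's"
  assumes carrier_nonempty: "S \<noteq> {}"
    and mul_closed: "\<lbrakk>x \<in> S; y \<in> S\<rbrakk> \<Longrightarrow> mul x y \<in> S"
    and mul_assoc: "\<lbrakk>x \<in> S; y \<in> S; z \<in> S\<rbrakk> \<Longrightarrow> mul (mul x y) z = mul x (mul y z)"

locale right_act = semigroup_on S mul
  for S :: "'s set" and mul :: "'s \<Rightarrow> 's \<Rightarrow> 's" +
  fixes A :: "'a set" and act :: "'a \<Rightarrow> 's \<Rightarrow> 'a"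
  assumes act_nonempty: "A \<noteq> {}"
    and act_closed: "\<lbrakk>a \<in> A; s \<in> S\<rbrakk> \<Longrightarrow> act a s \<in> A"
    and act_assoc: "\<lbrakk>a \<in> A; s \<in> S; t \<in> S\<rbrakk> \<Longrightarrow> act a (mul s t) = act (act a s) t"

definition subact :: "'s set \<Rightarrow> 'a set \<Rightarrow> ('a \<Rightarrow> 's \<Rightarrow> 'a) \<Rightarrow> 'a set \<Rightarrow> bool" where
  "subact S A act B \<longleftrightarrow> B \<noteq> {} \<and> B \<subseteq> A \<and> (\<forall>b\<in>B. \<forall>s\<in>S. act b s \<in> B)"

definition act_hom ::
  "'s set \<Rightarrow> 'a set \<Rightarrow> ('a \<Rightarrow> 's \<Rightarrow> 'a) \<Rightarrow> 'c set \<Rightarrow> ('c \<Rightarrow> 's \<Rightarrow> 'c) \<Rightarrow> ('a \<Rightarrow> 'c) \<Rightarrow> bool" where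
  "act_hom S A actA C actC f \<longleftrightarrow>
     (\<forall>a\<in>A. f a \<in> C) \<and> (\<forall>a\<in>A. \<forall>s\<in>S. f (actA a s) = actC (f a) s)"

definition nonzero_subact ::
  "'s set \<Rightarrow> 'a set \<Rightarrow> ('a \<Rightarrow> 's \<Rightarrow> 'a) \<Rightarrow> 'a set \<Rightarrow> bool" where
  "nonzero_subact S A act B \<longleftrightarrow> subact S A act B \<and> \<not> is_singleton B"

text \<open>
  The target act \<open>C\<close> has its carrier in the type of \<open>A\<close>. This loses nothing: see
  \<open>large_subact_any_target\<close> below, where the target has an arbitrary type.
\<close>

definition large_subact ::
  "'s set \<Rightarrow> ('s \<Rightarrow> 's \<Rightarrow> 's) \<Rightarrow> 'a set \<Rightarrow> ('a \<Rightarrow> 's \<Rightarrow> 'a) \<Rightarrow> 'a set \<Rightarrow> bool" where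
  "large_subact S mul A act B \<longleftrightarrow> subact S A act B \<and>
     (\<forall>(C :: 'a set) actC g. right_act S mul C actC \<longrightarrow> act_hom S A act C actC g \<longrightarrow>
        inj_on g B \<longrightarrow> inj_on g A)"

definition uniform_act ::
  "'s set \<Rightarrow> ('s \<Rightarrow> 's \<Rightarrow> 's) \<Rightarrow> 'a set \<Rightarrow> ('a \<Rightarrow> 's \<Rightarrow> 'a) \<Rightarrow> bool" where
  "uniform_act S mul A act \<longleftrightarrow>
     (\<forall>B. nonzero_subact S A act B \<longrightarrow> large_subact S mul A act B)"

definition uniform_semigroup :: "'s set \<Rightarrow> ('s \<Rightarrow> 's \<Rightarrow> 's) \<Rightarrow> bool" where
  "uniform_semigroup S mul \<longleftrightarrow> uniform_act S mul S mul"

definition has_identity :: "'s set \<Rightarrow> ('s \<Rightarrow> 's \<Rightarrow> 's) \<Rightarrow> bool" where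
  "has_identity S mul \<longleftrightarrow> (\<exists>e\<in>S. \<forall>x\<in>S. mul e x = x \<and> mul x e = x)"

definition has_zero :: "'s set \<Rightarrow> ('s \<Rightarrow> 's \<Rightarrow> 's) \<Rightarrow> bool" where
  "has_zero S mul \<longleftrightarrow> (\<exists>z\<in>S. \<forall>x\<in>S. mul z x = z \<and> mul x z = z)"

text \<open>
  \<open>S\<^sup>1\<close> and \<open>S\<^sup>0\<close> live in the option type, with \<open>Some\<close> embedding \<open>S\<close> and \<open>None\<close> the new element.
  If nothing needs to be adjoined, the carrier is the isomorphic copy \<open>Some ` S\<close> of \<open>S\<close>.
\<close>

definition adjoin_one_carrier :: "'s set \<Rightarrow> ('s \<Rightarrow> 's \<Rightarrow> 's) \<Rightarrow> 's option set" where
  "adjoin_one_carrier S mul =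
     (if has_identity S mul then Some ` S else insert None (Some ` S))"

fun adjoin_one_mul :: "('s \<Rightarrow> 's \<Rightarrow> 's) \<Rightarrow> 's option \<Rightarrow> 's option \<Rightarrow> 's option" where
  "adjoin_one_mul mul None y = y"
| "adjoin_one_mul mul (Some a) None = Some a"
| "adjoin_one_mul mul (Some a) (Some b) = Some (mul a b)"

definition adjoin_zero_carrier :: "'s set \<Rightarrow> ('s \<Rightarrow> 's \<Rightarrow> 's) \<Rightarrow> 's option set" where
  "adjoin_zero_carrier S mul =
     (if has_zero S mul then Some ` S else insert None (Some ` S))"

fun adjoin_zero_mul :: "('s \<Rightarrow> 's \<Rightarrow> 's) \<Rightarrow> 's option \<Rightarrow> 's option \<Rightarrow> 's option" where
  "adjoin_zero_mul mul None y = None"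
| "adjoin_zero_mul mul (Some a) None = None"
| "adjoin_zero_mul mul (Some a) (Some b) = Some (mul a b)"

lemma (in semigroup_on) regular_right_act: "right_act S mul S mul"
  by unfold_locales (auto simp: carrier_nonempty mul_closed mul_assoc)

lemma (in semigroup_on) adjoin_one_semigroup:
  "semigroup_on (adjoin_one_carrier S mul) (adjoin_one_mul mul)"
  by unfold_locales
    (auto simp: adjoin_one_carrier_def carrier_nonempty mul_closed mul_assoc split: if_splits)

lemma (in semigroup_on) adjoin_zero_semigroup:
  "semigroup_on (adjoin_zero_carrier S mul) (adjoin_zero_mul mul)"
  by unfold_locales
    (auto simp: adjoin_zero_carrier_def carrier_nonempty mul_closed mul_assoc split: if_splits)

text \<open>
  The image of \<open>g\<close> is transported into \<open>A\<close> by choosing a representative of each fibre.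
\<close>

lemma large_subact_any_target:
  fixes A :: "'a set" and C :: "'c set" and g :: "'a \<Rightarrow> 'c"
  assumes A: "right_act S mul A act"
    and large: "large_subact S mul A act B"
    and C: "right_act S mul C actC"
    and hom: "act_hom S A act C actC g"
    and inj: "inj_on g B"
  shows "inj_on g A"
proof -
  interpret A: right_act S mul A act by (rule A)
  define r where "r x = inv_into A g (g x)" for x
  have r_in: "r x \<in> A" and g_r: "g (r x) = g x" if "x \<in> A" for x
    using that unfolding r_def by (auto intro: inv_into_into f_inv_into_f)
  have g_act: "g (act x s) = actC (g x) s" if "x \<in> A" "s \<in> S" for x s
    using hom that unfolding act_hom_def by blast
  have r_cong: "r x = r y" if "g x = g y" for x y
    using that unfolding r_def by simp
  have r_act: "r (act (r x) s) = r (act x s)" if "x \<in> A" "s \<in> S" for x s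
    by (rule r_cong) (use that r_in g_r g_act in simp)
  define actD where "actD d s = r (act d s)" for d s
  have "right_act S mul (r ` A) actD"
  proof unfold_locales
    show "r ` A \<noteq> {}" using A.act_nonempty by simp
  next
    fix d s assume "d \<in> r ` A" "s \<in> S"
    then show "actD d s \<in> r ` A" unfolding actD_def using r_in A.act_closed by blast
  next
    fix d s t assume d: "d \<in> r ` A" and s: "s \<in> S" and t: "t \<in> S"
    have "d \<in> A" using d r_in by blast
    then show "actD d (mul s t) = actD (actD d s) t"
      unfolding actD_def using s t by (simp add: r_act A.act_closed A.act_assoc)
  qed
  moreover have "act_hom S A act (r ` A) actD r"
    unfolding act_hom_def actD_def using r_act by auto
  moreover have "B \<subseteq> A"
    using large unfolding large_subact_def subact_def by blast
  then have "inj_on r B"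
    using inj g_r by (metis inj_on_def subsetD)
  ultimately have "inj_on r A"
    using large unfolding large_subact_def by blast
  then show ?thesis
    using r_cong by (meson inj_on_def)
qed

end

theory Submission
  imports Defs
begin

text \<open>
  A homomorphism \<open>g\<close> from \<open>S\<close> extends to the enlarged semigroup by sending the new element to a
  new point of the target, which separates it from everything else. Hence if \<open>g\<close> is injective on
  a nonzero right ideal \<open>B\<close>, its extension is injective on \<open>B\<close> (in \<open>S\<^sup>1\<close>) or on
  \<open>B \<union> {0}\<close> (in \<open>S\<^sup>0\<close>), a nonzero right ideal there, so the extension and with it \<open>g\<close> are injective.
\<close>

lemma is_singleton_Some_image_iff: "is_singleton (Some ` B) \<longleftrightarrow> is_singleton B"
  by (auto simp: is_singleton_altdef card_image)

text \<open>Nonemptiness matters here: the empty set is not \<open>is_singleton\<close> either, yet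
  it has one-element supersets.\<close>

lemma not_is_singleton_superset:
  assumes "B \<subseteq> B'" "B \<noteq> {}" "\<not> is_singleton B"
  shows "\<not> is_singleton B'"
  using assms by (auto simp: is_singleton_def subset_singleton_iff)

lemma inj_on_map_option_Some_image_iff: "inj_on (map_option g) (Some ` B) \<longleftrightarrow> inj_on g B"
  by (auto simp: inj_on_def)

lemma uniform_semigroupD:
  fixes S C :: "'s set" and g :: "'s \<Rightarrow> 's"
  assumes "uniform_semigroup S mul" "subact S S mul B" "\<not> is_singleton B"
    and "right_act S mul C actC" "act_hom S S mul C actC g" "inj_on g B"
  shows "inj_on g S"
  using assms
  unfolding uniform_semigroup_def uniform_act_def large_subact_def nonzero_subact_def by blast

lemma uniform_semigroupI:
  fixes S :: "'s set"
  assumes "\<And>B (C :: 's set) actC g. \<lbrakk>subact S S mul B; \<not> is_singleton B; right_act S mul C actC;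
      act_hom S S mul C actC g; inj_on g B\<rbrakk> \<Longrightarrow> inj_on g S"
  shows "uniform_semigroup S mul"
  using assms
  unfolding uniform_semigroup_def uniform_act_def large_subact_def nonzero_subact_def by blast

lemma Some_image_subset_adjoin_one: "Some ` S \<subseteq> adjoin_one_carrier S mul"
  and Some_in_adjoin_one_iff: "Some x \<in> adjoin_one_carrier S mul \<longleftrightarrow> x \<in> S"
  by (auto simp: adjoin_one_carrier_def)

lemma Some_image_subset_adjoin_zero: "Some ` S \<subseteq> adjoin_zero_carrier S mul"
  and Some_in_adjoin_zero_iff: "Some x \<in> adjoin_zero_carrier S mul \<longleftrightarrow> x \<in> S"
  by (auto simp: adjoin_zero_carrier_def)

text \<open>
  The new point \<open>None\<close> of the target is the image of the adjoined identity, so \<open>s\<close> must map it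
  to \<open>g s\<close>.
\<close>

fun extend_act_one :: "('s \<Rightarrow> 'c) \<Rightarrow> ('c \<Rightarrow> 's \<Rightarrow> 'c) \<Rightarrow> 'c option \<Rightarrow> 's option \<Rightarrow> 'c option" where
  "extend_act_one g actC None y = map_option g y"
| "extend_act_one g actC (Some c) None = Some c"
| "extend_act_one g actC (Some c) (Some s) = Some (actC c s)"

text \<open>The only delicate case of the action law is at the new point: acting by
  \<open>mul s t\<close> gives \<open>g (mul s t)\<close>, acting by \<open>s\<close> and then
  \<open>t\<close> gives \<open>actC (g s) t\<close>, and these agree because \<open>g\<close> is a
  homomorphism.\<close>

lemma right_act_extend_act_one:
  assumes "right_act S mul C actC" and hom: "act_hom S S mul C actC g"
  shows "right_act (adjoin_one_carrier S mul) (adjoin_one_mul mul)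
    (insert None (Some ` C)) (extend_act_one g actC)"
proof -
  interpret right_act S mul C actC by fact
  interpret T: semigroup_on "adjoin_one_carrier S mul" "adjoin_one_mul mul"
    by (rule adjoin_one_semigroup)
  have g_in: "g s \<in> C" if "s \<in> S" for s
    using hom that by (auto simp: act_hom_def)
  have g_mul: "g (mul s t) = actC (g s) t" if "s \<in> S" "t \<in> S" for s t
    using hom that by (auto simp: act_hom_def)
  show ?thesis
  proof unfold_locales
    fix a s assume "a \<in> insert None (Some ` C)" "s \<in> adjoin_one_carrier S mul"
    then show "extend_act_one g actC a s \<in> insert None (Some ` C)"
      by (cases a; cases s) (auto simp: Some_in_adjoin_one_iff g_in act_closed)
  next
    fix a s t
    assume "a \<in> insert None (Some ` C)" "s \<in> adjoin_one_carrier S mul" "t \<in> adjoin_one_carrier S mul"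
    then show "extend_act_one g actC a (adjoin_one_mul mul s t)
        = extend_act_one g actC (extend_act_one g actC a s) t"
      by (cases a; cases s; cases t) (auto simp: Some_in_adjoin_one_iff g_mul act_assoc)
  qed simp
qed

text \<open>If \<open>S\<close> already has an identity, \<open>None\<close> is just an additional
  target point outside the image of \<open>map_option g\<close>.\<close>

lemma act_hom_extend_act_one:
  assumes "act_hom S S mul C actC g"
  shows "act_hom (adjoin_one_carrier S mul) (adjoin_one_carrier S mul) (adjoin_one_mul mul)
    (insert None (Some ` C)) (extend_act_one g actC) (map_option g)"
  using assms by (auto simp: act_hom_def adjoin_one_carrier_def split: if_splits)

text \<open>The copy of \<open>B\<close> stays closed without any new element, since an adjoined
  identity fixes each of its points.\<close>

lemma subact_adjoin_one:
  assumes "subact S S mul B"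
  shows "subact (adjoin_one_carrier S mul) (adjoin_one_carrier S mul) (adjoin_one_mul mul) (Some ` B)"
  using assms by (auto simp: subact_def adjoin_one_carrier_def split: if_splits)

lemma uniform_semigroup_if_adjoin_one:
  fixes S :: "'s set"
  assumes unif: "uniform_semigroup (adjoin_one_carrier S mul) (adjoin_one_mul mul)"
  shows "uniform_semigroup S mul"
proof (rule uniform_semigroupI)
  fix B C :: "'s set" and actC g
  assume B: "subact S S mul B" "\<not> is_singleton B" and C: "right_act S mul C actC"
    and g: "act_hom S S mul C actC g" "inj_on g B"
  \<comment> \<open>The enlarged target has type \<open>'s option\<close>, the type of the enlarged
    semigroup, so it is an admissible target in \<open>large_subact\<close>.\<close>
  have "inj_on (map_option g) (adjoin_one_carrier S mul)"
  proof (rule uniform_semigroupD[OF unif subact_adjoin_one[OF B(1)] _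
        right_act_extend_act_one[OF C g(1)] act_hom_extend_act_one[OF g(1)]])
    show "\<not> is_singleton (Some ` B)"
      using B(2) by (simp only: is_singleton_Some_image_iff not_False_eq_True)
    show "inj_on (map_option g) (Some ` B)"
      using g(2) by (simp only: inj_on_map_option_Some_image_iff)
  qed
  then have "inj_on (map_option g) (Some ` S)"
    by (rule inj_on_subset) (rule Some_image_subset_adjoin_one)
  then show "inj_on g S"
    by (simp only: inj_on_map_option_Some_image_iff)
qed

text \<open>The formula for the product with a zero serves as an action too: \<open>None\<close>
  becomes a fixed point of the target, and an adjoined zero sends every point to it.\<close>

lemma right_act_adjoin_zero:
  assumes "right_act S mul C actC"
  shows "right_act (adjoin_zero_carrier S mul) (adjoin_zero_mul mul)
    (insert None (Some ` C)) (adjoin_zero_mul actC)"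
proof -
  interpret right_act S mul C actC by fact
  interpret T: semigroup_on "adjoin_zero_carrier S mul" "adjoin_zero_mul mul"
    by (rule adjoin_zero_semigroup)
  show ?thesis
  proof unfold_locales
    fix a s assume "a \<in> insert None (Some ` C)" "s \<in> adjoin_zero_carrier S mul"
    then show "adjoin_zero_mul actC a s \<in> insert None (Some ` C)"
      by (cases a; cases s) (auto simp: Some_in_adjoin_zero_iff act_closed)
  next
    fix a s t
    assume "a \<in> insert None (Some ` C)" "s \<in> adjoin_zero_carrier S mul" "t \<in> adjoin_zero_carrier S mul"
    then show "adjoin_zero_mul actC a (adjoin_zero_mul mul s t)
        = adjoin_zero_mul actC (adjoin_zero_mul actC a s) t"
      by (cases a; cases s; cases t) (auto simp: Some_in_adjoin_zero_iff act_assoc)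
  qed simp
qed

lemma act_hom_adjoin_zero:
  assumes "act_hom S S mul C actC g"
  shows "act_hom (adjoin_zero_carrier S mul) (adjoin_zero_carrier S mul) (adjoin_zero_mul mul)
    (insert None (Some ` C)) (adjoin_zero_mul actC) (map_option g)"
  using assms by (auto simp: act_hom_def adjoin_zero_carrier_def split: if_splits)

text \<open>An adjoined zero lies in every right ideal, because \<open>b\<close> times zero is zero.
  The intersection adds it exactly when the carrier contains it.\<close>

lemma subact_adjoin_zero:
  assumes "subact S S mul B"
  shows "subact (adjoin_zero_carrier S mul) (adjoin_zero_carrier S mul) (adjoin_zero_mul mul)
    (Some ` B \<union> ({None} \<inter> adjoin_zero_carrier S mul))"
  using assms by (auto simp: subact_def adjoin_zero_carrier_def split: if_splits)

lemma uniform_semigroup_if_adjoin_zero: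
  fixes S :: "'s set"
  assumes unif: "uniform_semigroup (adjoin_zero_carrier S mul) (adjoin_zero_mul mul)"
  shows "uniform_semigroup S mul"
proof (rule uniform_semigroupI)
  fix B C :: "'s set" and actC g
  assume B: "subact S S mul B" "\<not> is_singleton B" and C: "right_act S mul C actC"
    and g: "act_hom S S mul C actC g" "inj_on g B"
  let ?B = "Some ` B \<union> ({None} \<inter> adjoin_zero_carrier S mul)"
  have "\<not> is_singleton ?B"
    by (rule not_is_singleton_superset[of "Some ` B"])
      (use B in \<open>auto simp: is_singleton_Some_image_iff subact_def\<close>)
  \<comment> \<open>Injectivity on this possibly larger set covers both cases, whether or not a zero
    was adjoined.\<close>
  moreover have "inj_on (map_option g) (insert None (Some ` B))"
    using g(2) by (auto simp: inj_on_map_option_Some_image_iff)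
  then have "inj_on (map_option g) ?B"
    by (rule inj_on_subset) blast
  ultimately have "inj_on (map_option g) (adjoin_zero_carrier S mul)"
    by (rule uniform_semigroupD[OF unif subact_adjoin_zero[OF B(1)] _ right_act_adjoin_zero[OF C]
          act_hom_adjoin_zero[OF g(1)]])
  then have "inj_on (map_option g) (Some ` S)"
    by (rule inj_on_subset) (rule Some_image_subset_adjoin_zero)
  then show "inj_on g S"
    by (simp only: inj_on_map_option_Some_image_iff)
qed

theorem lemma2p5:
  fixes S :: "'s set" and mul :: "'s \<Rightarrow> 's \<Rightarrow> 's"
  assumes "semigroup_on S mul"
    and "infinite S \<or> card S \<ge> 2"
  shows "(uniform_semigroup (adjoin_one_carrier S mul) (adjoin_one_mul mul)
            \<longrightarrow> uniform_semigroup S mul)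
       \<and> (uniform_semigroup (adjoin_zero_carrier S mul) (adjoin_zero_mul mul)
            \<longrightarrow> uniform_semigroup S mul)"
  using uniform_semigroup_if_adjoin_one uniform_semigroup_if_adjoin_zero by blast

end
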